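(* For each $i\in\{1,2\}$, let $X_i$ be a Banach space and let $V_i$ be a non-empty closed convex subset of $X_i$. Let $X=X_1\oplus_\infty X_2$ and $V=V_1\times V_2$. If $(X_i,V_i,\mathcal{CB}(X_i))$ has property-$(P_1)$ for each $i\in\{1,2\}$, then $(X,V,\mathcal{CB}(X))$ has property-$(P_1)$.
   Context: All Banach spaces are real. $X_1\oplus_\infty X_2$ is $X_1\times X_2$ with the norm $\|(x_1,x_2)\|=\max\{\|x_1\|,\|x_2\|\}$. For a Banach space $E$, $B_E$ is its closed unit ball and $\mathcal{CB}(E)$ is the class of non-empty closed bounded subsets of $E$. For $v\in E$ and a non-empty bounded set $F\subseteq E$, $r(v,F)=\sup_{z\in F}\|v-z\|$. For a non-empty closed convex $V\subseteq E$: $\mathrm{rad}_V(F)=\inf_{v\in V}r(v,F)$, $\mathrm{cent}_V(F)=\{v\in V: r(v,F)=\mathrm{rad}_V(F)\}$, and for $\delta>0$, $\mathrm{cent}_V(F,\delta)=\{v\in V: r(v,F)\le \mathrm{rad}_V(F)+\delta\}$. For $\mathscr F\subseteq\mathcal{CB}(E)$, the pair $(V,\mathscr F)$ has the restricted center property (r.c.p.) if $\mathrm{cent}_V(F)\ne\emptyset$ for every $F\in\mathscr F$. The triplet $(E,V,\mathscr F)$ has property-$(P_1)$ if $(V,\mathscr F)$ has r.c.p. and for every $\varepsilon>0$ and $F\in\mathscr F$ there is $\delta>0$ with $\mathrm{cent}_V(F,\delta)\subseteq\mathrm{cent}_V(F)+\varepsilon B_E$. *)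

theory Defs
  imports "HOL-Analysis.Analysis"
begin

text \<open>The library's norm on \<open>'a \<times> 'b\<close> is the Euclidean one, so the \<open>\<ell>\<^sub>\<infinity>\<close>-sum of two
  normed spaces is introduced as a separate type, a copy of the product carrying the maximum norm.\<close>

typedef ('a, 'b) inf_sum = "UNIV :: ('a \<times> 'b) set"
  morphisms to_pair of_pair ..

type_notation inf_sum (infixr "\<oplus>\<^sub>\<infinity>" 20)

setup_lifting type_definition_inf_sum

instantiation inf_sum :: (real_vector, real_vector) real_vector
begin

lift_definition zero_inf_sum :: "'a \<oplus>\<^sub>\<infinity> 'b" is "0" .
lift_definition plus_inf_sum :: "'a \<oplus>\<^sub>\<infinity> 'b \<Rightarrow> 'a \<oplus>\<^sub>\<infinity> 'b \<Rightarrow> 'a \<oplus>\<^sub>\<infinity> 'b" is "(+)" .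
lift_definition uminus_inf_sum :: "'a \<oplus>\<^sub>\<infinity> 'b \<Rightarrow> 'a \<oplus>\<^sub>\<infinity> 'b" is "uminus" .
lift_definition minus_inf_sum :: "'a \<oplus>\<^sub>\<infinity> 'b \<Rightarrow> 'a \<oplus>\<^sub>\<infinity> 'b \<Rightarrow> 'a \<oplus>\<^sub>\<infinity> 'b" is "(-)" .
lift_definition scaleR_inf_sum :: "real \<Rightarrow> 'a \<oplus>\<^sub>\<infinity> 'b \<Rightarrow> 'a \<oplus>\<^sub>\<infinity> 'b" is "scaleR" .

instance
  by standard (transfer, simp add: algebra_simps)+

end

instantiation inf_sum :: (real_normed_vector, real_normed_vector) real_normed_vector
begin

lift_definition norm_inf_sum :: "'a \<oplus>\<^sub>\<infinity> 'b \<Rightarrow> real" is "\<lambda>x. max (norm (fst x)) (norm (snd x))" .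

definition sgn_inf_sum :: "'a \<oplus>\<^sub>\<infinity> 'b \<Rightarrow> 'a \<oplus>\<^sub>\<infinity> 'b"
  where "sgn_inf_sum x = inverse (norm x) *\<^sub>R x"

definition dist_inf_sum :: "'a \<oplus>\<^sub>\<infinity> 'b \<Rightarrow> 'a \<oplus>\<^sub>\<infinity> 'b \<Rightarrow> real"
  where "dist_inf_sum x y = norm (x - y)"

definition uniformity_inf_sum :: "(('a \<oplus>\<^sub>\<infinity> 'b) \<times> ('a \<oplus>\<^sub>\<infinity> 'b)) filter"
  where "uniformity_inf_sum = (INF e\<in>{0 <..}. principal {(x, y). dist x y < e})"

definition open_inf_sum :: "('a \<oplus>\<^sub>\<infinity> 'b) set \<Rightarrow> bool"
  where "open_inf_sum U \<longleftrightarrow> (\<forall>x\<in>U. \<forall>\<^sub>F (x', y) in uniformity. x' = x \<longrightarrow> y \<in> U)"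

instance
proof
  fix x y :: "'a \<oplus>\<^sub>\<infinity> 'b" and a :: real
  show "norm x = 0 \<longleftrightarrow> x = 0"
    by transfer (auto simp: prod_eq_iff max_def)
  show "norm (x + y) \<le> norm x + norm y"
    by transfer (auto intro!: order.trans[OF norm_triangle_ineq] add_mono)
  show "norm (a *\<^sub>R x) = \<bar>a\<bar> * norm x"
    by transfer (simp add: max_mult_distrib_left)
qed (simp_all add: sgn_inf_sum_def dist_inf_sum_def uniformity_inf_sum_def open_inf_sum_def)

end

lemma norm_of_pair: "norm (of_pair (a, b)) = max (norm a) (norm b)"
  by (simp add: norm_inf_sum.abs_eq)

lemma dist_inf_sum_eq:
  "dist x y = max (dist (fst (to_pair x)) (fst (to_pair y))) (dist (snd (to_pair x)) (snd (to_pair y)))"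
  unfolding dist_norm by transfer simp

instance inf_sum :: (banach, banach) banach
proof
  fix X :: "nat \<Rightarrow> 'a \<oplus>\<^sub>\<infinity> 'b"
  assume X: "Cauchy X"
  have "Cauchy (\<lambda>n. fst (to_pair (X n)))" "Cauchy (\<lambda>n. snd (to_pair (X n)))"
    using X by (force simp: Cauchy_def dist_inf_sum_eq)+
  then obtain a b where a: "(\<lambda>n. fst (to_pair (X n))) \<longlonglongrightarrow> a" and b: "(\<lambda>n. snd (to_pair (X n))) \<longlonglongrightarrow> b"
    by (meson Cauchy_convergent convergent_def)
  have "X \<longlonglongrightarrow> of_pair (a, b)"
    unfolding tendsto_iff
  proof (intro allI impI)
    fix e :: real assume "e > 0"
    with a b have "\<forall>\<^sub>F n in sequentially. dist (fst (to_pair (X n))) a < e"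
      "\<forall>\<^sub>F n in sequentially. dist (snd (to_pair (X n))) b < e"
      by (auto simp: tendsto_iff)
    then show "\<forall>\<^sub>F n in sequentially. dist (X n) (of_pair (a, b)) < e"
      by eventually_elim (simp add: dist_inf_sum_eq of_pair_inverse)
  qed
  then show "convergent X"
    by (auto simp: convergent_def)
qed

text \<open>The suprema and infima below are taken in \<^typ>\<open>real\<close>; they are the intended ones for
  \<open>F\<close> non-empty and bounded and \<open>V\<close> non-empty.\<close>

definition CB :: "'a::real_normed_vector set set" where
  "CB = {F. F \<noteq> {} \<and> closed F \<and> bounded F}"

definition far_radius :: "'a::real_normed_vector \<Rightarrow> 'a set \<Rightarrow> real" where
  "far_radius v F = (SUP z\<in>F. norm (v - z))"

definition rad :: "'a::real_normed_vector set \<Rightarrow> 'a set \<Rightarrow> real" where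
  "rad V F = (INF v\<in>V. far_radius v F)"

definition cent :: "'a::real_normed_vector set \<Rightarrow> 'a set \<Rightarrow> 'a set" where
  "cent V F = {v \<in> V. far_radius v F = rad V F}"

definition near_cent :: "'a::real_normed_vector set \<Rightarrow> 'a set \<Rightarrow> real \<Rightarrow> 'a set" where
  "near_cent V F \<delta> = {v \<in> V. far_radius v F \<le> rad V F + \<delta>}"

definition rcp :: "'a::real_normed_vector set \<Rightarrow> 'a set set \<Rightarrow> bool" where
  "rcp V \<F> \<longleftrightarrow> (\<forall>F\<in>\<F>. cent V F \<noteq> {})"

definition property_P1 :: "'a::real_normed_vector set \<Rightarrow> 'a set set \<Rightarrow> bool" where
  "property_P1 V \<F> \<longleftrightarrow> rcp V \<F> \<and>
     (\<forall>\<epsilon>>0. \<forall>F\<in>\<F>. \<exists>\<delta>>0.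
        near_cent V F \<delta> \<subseteq> {c + \<epsilon> *\<^sub>R b | c b. c \<in> cent V F \<and> b \<in> cball 0 1})"

end

theory Submission
  imports Defs
begin

text \<open>Let \<open>F\<^sub>1\<close>, \<open>F\<^sub>2\<close> be the closed coordinate projections of \<open>F\<close>. Since
  \<open>r((v\<^sub>1, v\<^sub>2), F) = max (r(v\<^sub>1, F\<^sub>1)) (r(v\<^sub>2, F\<^sub>2))\<close>, the radius of \<open>F\<close> is the larger of the
  two radii, \<open>R\<close> say, and centers of \<open>F\<close> are the pairs with \<open>r(v\<^sub>i, F\<^sub>i) \<le> R\<close> for both \<open>i\<close>. So it
  suffices that \<open>r(v\<^sub>i, F\<^sub>i) \<le> R + \<delta>\<close> forces \<open>v\<^sub>i\<close> to be close to a point of \<open>V\<^sub>i\<close> with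
  \<open>r(\<cdot>, F\<^sub>i) \<le> R\<close>. If \<open>R\<close> is the radius of \<open>F\<^sub>i\<close>, this is property \<open>(P\<^sub>1)\<close>; if \<open>R\<close> is larger,
  one moves \<open>v\<^sub>i\<close> slightly towards a center of \<open>F\<^sub>i\<close>.\<close>

lemma far_radius_le_iff:
  assumes "bounded F" "F \<noteq> {}"
  shows "far_radius v F \<le> r \<longleftrightarrow> (\<forall>z\<in>F. norm (v - z) \<le> r)"
proof -
  obtain e where "\<And>z. z \<in> F \<Longrightarrow> dist v z \<le> e"
    using assms(1) by (meson bounded_any_center)
  \<comment> \<open>The real-valued \<open>SUP\<close> is a genuine least upper bound only once the
    distances are bounded above.\<close>
  then have "bdd_above ((\<lambda>z. norm (v - z)) ` F)"
    by (auto simp: bdd_above_def dist_norm)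
  then show ?thesis
    unfolding far_radius_def using assms(2) by (simp add: cSUP_le_iff)
qed

lemma norm_diff_le_far_radius:
  assumes "bounded F" "z \<in> F"
  shows "norm (v - z) \<le> far_radius v F"
  using far_radius_le_iff[OF assms(1), of v "far_radius v F"] assms(2) by auto

lemma far_radius_nonneg:
  assumes "bounded F" "F \<noteq> {}"
  shows "0 \<le> far_radius v F"
  using assms norm_diff_le_far_radius norm_ge_zero order_trans by (metis ex_in_conv)

text \<open>A closed ball about \<open>v\<close> that contains \<open>F\<close> also contains its
  closure.\<close>

lemma far_radius_closure:
  assumes "bounded F" "F \<noteq> {}"
  shows "far_radius v (closure F) = far_radius v F"
proof (rule antisym)
  have "closure F \<subseteq> cball v (far_radius v F)"
    using norm_diff_le_far_radius[OF assms(1)]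
    by (intro closure_minimal) (auto simp: dist_norm)
  then show "far_radius v (closure F) \<le> far_radius v F"
    using assms by (subst far_radius_le_iff) (auto simp: dist_norm)
  show "far_radius v F \<le> far_radius v (closure F)"
    using assms closure_subset[of F]
    by (subst far_radius_le_iff) (auto intro!: norm_diff_le_far_radius)
qed

lemma rad_le_far_radius:
  assumes "bounded F" "F \<noteq> {}" "v \<in> V"
  shows "rad V F \<le> far_radius v F"
  unfolding rad_def using assms far_radius_nonneg[OF assms(1,2)]
  by (intro cINF_lower bdd_belowI2[where m = 0])

lemma rad_eqI:
  assumes "c \<in> V" "far_radius c F = r" "\<And>v. v \<in> V \<Longrightarrow> r \<le> far_radius v F"
  shows "rad V F = r"
  unfolding rad_def using assms by (intro cInf_eq_minimum) auto

lemma far_radius_convex: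
  assumes "bounded F" "F \<noteq> {}" "0 \<le> t" "t \<le> 1"
  shows "far_radius ((1 - t) *\<^sub>R v + t *\<^sub>R w) F \<le> (1 - t) * far_radius v F + t * far_radius w F"
proof (subst far_radius_le_iff[OF assms(1,2)], intro ballI)
  fix z assume "z \<in> F"
  have "norm ((1 - t) *\<^sub>R v + t *\<^sub>R w - z) = norm ((1 - t) *\<^sub>R (v - z) + t *\<^sub>R (w - z))"
    by (simp add: algebra_simps)
  also have "\<dots> \<le> (1 - t) * norm (v - z) + t * norm (w - z)"
    using assms by (intro order.trans[OF norm_triangle_ineq]) simp
  also have "\<dots> \<le> (1 - t) * far_radius v F + t * far_radius w F"
    using assms \<open>z \<in> F\<close> by (intro add_mono mult_left_mono norm_diff_le_far_radius) auto
  finally show "norm ((1 - t) *\<^sub>R v + t *\<^sub>R w - z) \<le> \<dots>" .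
qed

text \<open>By convexity of \<open>far_radius\<close>, sliding \<open>v\<close> a small fraction of
  the way towards \<open>c\<close>, which lies strictly inside the sublevel set, absorbs the excess
  \<delta>. The slide is short because \<open>norm (v - c)\<close> has a bound independent of
  \<open>v\<close>.\<close>

lemma near_sublevel_above_rad:
  assumes "convex V" "bounded F" "F \<noteq> {}" "c \<in> V" "far_radius c F < R" "0 < \<epsilon>"
  shows "\<exists>\<delta>>0. \<forall>v\<in>V. far_radius v F \<le> R + \<delta> \<longrightarrow>
           (\<exists>w\<in>V. far_radius w F \<le> R \<and> norm (v - w) \<le> \<epsilon>)"
proof -
  define s where "s = far_radius c F"
  \<comment> \<open>\<open>M\<close> will bound \<open>norm (v - c)\<close>; capping \<delta> at 1
    keeps \<open>M\<close> independent of \<delta>.\<close>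
  define M where "M = R + 1 + s"
  define \<delta> where "\<delta> = min 1 (\<epsilon> * (R - s) / M)"
  have s: "0 \<le> s" "s < R"
    using assms far_radius_nonneg by (auto simp: s_def)
  then have M: "0 < M"
    by (simp add: M_def)
  have \<delta>: "0 < \<delta>" "\<delta> \<le> 1" "\<delta> * M \<le> \<epsilon> * (R - s)"
    using s M \<open>0 < \<epsilon>\<close> by (auto simp: \<delta>_def min_def field_simps)
  \<comment> \<open>This is the solution of
    \<open>(1 - t) * (R + \<delta>) + t * s = R\<close>.\<close>
  define t where "t = \<delta> / (R - s + \<delta>)"
  have t: "0 \<le> t" "t \<le> 1" "t * (R - s + \<delta>) = \<delta>"
    using s \<delta> by (auto simp: t_def)
  have tM: "t * M \<le> \<epsilon>"
  proof -
    have "\<epsilon> * (R - s) \<le> \<epsilon> * (R - s + \<delta>)"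
      using \<delta> \<open>0 < \<epsilon>\<close> by simp
    then show ?thesis
      using s \<delta> by (simp add: t_def divide_le_eq)
  qed
  \<comment> \<open>Any point of \<open>F\<close> links \<open>v\<close> to \<open>c\<close> in the
    triangle inequality.\<close>
  obtain z where z: "z \<in> F"
    using assms by auto
  have "\<exists>w\<in>V. far_radius w F \<le> R \<and> norm (v - w) \<le> \<epsilon>"
    if v: "v \<in> V" "far_radius v F \<le> R + \<delta>" for v
  proof (intro bexI conjI)
    let ?w = "(1 - t) *\<^sub>R v + t *\<^sub>R c"
    show "?w \<in> V"
      using assms v t by (intro convexD_alt) auto
    have "far_radius ?w F \<le> (1 - t) * far_radius v F + t * s"
      unfolding s_def using assms t by (intro far_radius_convex)
    also have "\<dots> \<le> (1 - t) * (R + \<delta>) + t * s"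
      using v t by (intro add_right_mono mult_left_mono) auto
    also have "\<dots> = R"
      using t(3) by (simp add: algebra_simps)
    finally show "far_radius ?w F \<le> R" .
    have "norm (v - c) \<le> norm (v - z) + norm (c - z)"
      using norm_triangle_ineq4[of "v - z" "c - z"] by simp
    also have "\<dots> \<le> far_radius v F + s"
      unfolding s_def using assms z by (intro add_mono norm_diff_le_far_radius)
    also have "\<dots> \<le> M"
      using v \<delta> by (simp add: M_def)
    finally have "t * norm (v - c) \<le> t * M"
      using t by (intro mult_left_mono)
    moreover have "v - ?w = t *\<^sub>R (v - c)"
      by (simp add: algebra_simps)
    ultimately show "norm (v - ?w) \<le> \<epsilon>"
      using t tM by simp
  qed
  with \<delta> show ?thesis
    by blast
qed

text \<open>\<open>R\<close> may exceed \<open>rad V F\<close> because in the product the coordinate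
  with the smaller radius is constrained only by the larger one.\<close>

lemma property_P1_near_sublevel:
  assumes "property_P1 V \<F>" "F \<in> \<F>" "convex V" "bounded F" "F \<noteq> {}" "rad V F \<le> R" "0 < \<epsilon>"
  shows "\<exists>\<delta>>0. \<forall>v\<in>V. far_radius v F \<le> R + \<delta> \<longrightarrow>
           (\<exists>w\<in>V. far_radius w F \<le> R \<and> norm (v - w) \<le> \<epsilon>)"
proof (cases "rad V F = R")
  case True
  obtain \<delta> where "\<delta> > 0"
    and \<delta>: "near_cent V F \<delta> \<subseteq> {c + \<epsilon> *\<^sub>R b | c b. c \<in> cent V F \<and> b \<in> cball 0 1}"
    using assms unfolding property_P1_def by meson
  have "\<exists>w\<in>V. far_radius w F \<le> R \<and> norm (v - w) \<le> \<epsilon>"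
    if "v \<in> V" "far_radius v F \<le> R + \<delta>" for v
  proof -
    have "v \<in> near_cent V F \<delta>"
      using that True by (simp add: near_cent_def)
    with \<delta> obtain c b where "v = c + \<epsilon> *\<^sub>R b" "c \<in> cent V F" "norm b \<le> 1"
      by auto
    then show ?thesis
      using True \<open>0 < \<epsilon>\<close> by (intro bexI[of _ c]) (auto simp: cent_def mult_left_le)
  qed
  with \<open>\<delta> > 0\<close> show ?thesis
    by blast
next
  case False
  obtain c where "c \<in> cent V F"
    using assms unfolding property_P1_def rcp_def by blast
  then show ?thesis
    using assms False by (intro near_sublevel_above_rad) (auto simp: cent_def)
qed

lemma norm_fst_to_pair_le: "norm (fst (to_pair x)) \<le> norm x"
  and norm_snd_to_pair_le: "norm (snd (to_pair x)) \<le> norm x"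
  by (simp_all add: norm_inf_sum.rep_eq)

lemma bounded_fst_to_pair:
  assumes "bounded F"
  shows "bounded ((\<lambda>x. fst (to_pair x)) ` F)"
proof -
  obtain a where "\<And>x. x \<in> F \<Longrightarrow> norm x \<le> a"
    using assms by (auto simp: bounded_iff)
  then have "norm (fst (to_pair x)) \<le> a" if "x \<in> F" for x
    using that norm_fst_to_pair_le[of x] by (meson order_trans)
  then show ?thesis
    by (auto simp: bounded_iff)
qed

lemma bounded_snd_to_pair:
  assumes "bounded F"
  shows "bounded ((\<lambda>x. snd (to_pair x)) ` F)"
proof -
  obtain a where "\<And>x. x \<in> F \<Longrightarrow> norm x \<le> a"
    using assms by (auto simp: bounded_iff)
  then have "norm (snd (to_pair x)) \<le> a" if "x \<in> F" for x
    using that norm_snd_to_pair_le[of x] by (meson order_trans)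
  then show ?thesis
    by (auto simp: bounded_iff)
qed

text \<open>A pointwise maximum is at most \<open>r\<close> exactly when both coordinates are, so
  the two sides have the same upper bounds \<open>r\<close>; taking each side for \<open>r\<close>
  gives equality.\<close>

lemma far_radius_of_pair:
  assumes "F \<in> CB"
  shows "far_radius (of_pair (v, w)) F =
    max (far_radius v (closure ((\<lambda>x. fst (to_pair x)) ` F))) (far_radius w (closure ((\<lambda>x. snd (to_pair x)) ` F)))"
proof -
  have F: "bounded F" "F \<noteq> {}"
    using assms by (auto simp: CB_def)
  have "norm (of_pair (v, w) - z) =
      max (norm (v - fst (to_pair z))) (norm (w - snd (to_pair z)))" for z
    by (simp add: norm_inf_sum.rep_eq minus_inf_sum.rep_eq of_pair_inverse)
  then have "far_radius (of_pair (v, w)) F \<le> r \<longleftrightarrow>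
      max (far_radius v ((\<lambda>x. fst (to_pair x)) ` F)) (far_radius w ((\<lambda>x. snd (to_pair x)) ` F)) \<le> r" for r
    using F bounded_fst_to_pair[OF F(1)] bounded_snd_to_pair[OF F(1)]
    by (auto simp: far_radius_le_iff)
  then show ?thesis
    using F bounded_fst_to_pair[OF F(1)] bounded_snd_to_pair[OF F(1)]
    by (simp only: far_radius_closure image_is_empty not_False_eq_True)
      (meson order.antisym order.refl)
qed

theorem theorem3p5:
  fixes V\<^sub>1 :: "'a::banach set" and V\<^sub>2 :: "'b::banach set"
  assumes "V\<^sub>1 \<noteq> {}" and "closed V\<^sub>1" and "convex V\<^sub>1"
    and "V\<^sub>2 \<noteq> {}" and "closed V\<^sub>2" and "convex V\<^sub>2"
    and "property_P1 V\<^sub>1 (CB :: 'a set set)"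
    and "property_P1 V\<^sub>2 (CB :: 'b set set)"
  shows "property_P1 (of_pair ` (V\<^sub>1 \<times> V\<^sub>2) :: ('a \<oplus>\<^sub>\<infinity> 'b) set) (CB :: ('a \<oplus>\<^sub>\<infinity> 'b) set set)"
proof -
  let ?V = "of_pair ` (V\<^sub>1 \<times> V\<^sub>2) :: ('a \<oplus>\<^sub>\<infinity> 'b) set"
  have "cent ?V F \<noteq> {} \<and> (\<forall>\<epsilon>>0. \<exists>\<delta>>0.
      near_cent ?V F \<delta> \<subseteq> {c + \<epsilon> *\<^sub>R b | c b. c \<in> cent ?V F \<and> b \<in> cball 0 1})"
    if F: "F \<in> CB" for F :: "('a \<oplus>\<^sub>\<infinity> 'b) set"
  proof -
    \<comment> \<open>Projections of a closed set need not be closed; the closures put both sets in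
      \<open>CB\<close>, where the hypotheses apply.\<close>
    define F\<^sub>1 where "F\<^sub>1 = closure ((\<lambda>x. fst (to_pair x)) ` F)"
    define F\<^sub>2 where "F\<^sub>2 = closure ((\<lambda>x. snd (to_pair x)) ` F)"
    define R where "R = max (rad V\<^sub>1 F\<^sub>1) (rad V\<^sub>2 F\<^sub>2)"
    have CB: "F\<^sub>1 \<in> CB" "F\<^sub>2 \<in> CB"
      using F by (auto simp: CB_def F\<^sub>1_def F\<^sub>2_def bounded_fst_to_pair bounded_snd_to_pair)
    then have F12: "bounded F\<^sub>1" "F\<^sub>1 \<noteq> {}" "bounded F\<^sub>2" "F\<^sub>2 \<noteq> {}"
      by (auto simp: CB_def)
    have far: "far_radius (of_pair (v, w)) F = max (far_radius v F\<^sub>1) (far_radius w F\<^sub>2)" for v w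
      unfolding F\<^sub>1_def F\<^sub>2_def by (rule far_radius_of_pair[OF F])
    obtain c\<^sub>1 c\<^sub>2 where c: "c\<^sub>1 \<in> cent V\<^sub>1 F\<^sub>1" "c\<^sub>2 \<in> cent V\<^sub>2 F\<^sub>2"
      using assms CB unfolding property_P1_def rcp_def by blast
    have R_le: "R \<le> far_radius (of_pair (v, w)) F" if "v \<in> V\<^sub>1" "w \<in> V\<^sub>2" for v w
      unfolding far R_def using that F12 by (intro max.mono rad_le_far_radius)
    have rad: "rad ?V F = R"
      using c R_le by (intro rad_eqI[of "of_pair (c\<^sub>1, c\<^sub>2)"]) (auto simp: far R_def cent_def)
    \<comment> \<open>The lower bound \<open>R_le\<close> turns these inequalities into equality of
      the maximum with \<open>R\<close>. The coordinate with the smaller radius need not be a center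
      itself.\<close>
    have cent: "of_pair (v, w) \<in> cent ?V F"
      if "v \<in> V\<^sub>1" "w \<in> V\<^sub>2" "far_radius v F\<^sub>1 \<le> R" "far_radius w F\<^sub>2 \<le> R" for v w
      using that R_le[OF that(1,2)] by (auto simp: cent_def rad far)
    have "of_pair (c\<^sub>1, c\<^sub>2) \<in> cent ?V F"
      using c by (intro cent) (auto simp: cent_def R_def)
    moreover have "\<exists>\<delta>>0. near_cent ?V F \<delta> \<subseteq> {c + \<epsilon> *\<^sub>R b | c b. c \<in> cent ?V F \<and> b \<in> cball 0 1}"
      if \<epsilon>: "\<epsilon> > 0" for \<epsilon>
    proof -
      obtain \<delta>\<^sub>1 where "\<delta>\<^sub>1 > 0" and \<delta>\<^sub>1: "\<And>v. v \<in> V\<^sub>1 \<Longrightarrow> far_radius v F\<^sub>1 \<le> R + \<delta>\<^sub>1 \<Longrightarrow>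
          \<exists>w\<in>V\<^sub>1. far_radius w F\<^sub>1 \<le> R \<and> norm (v - w) \<le> \<epsilon>"
        using property_P1_near_sublevel[OF assms(7) CB(1) assms(3) F12(1,2) _ \<epsilon>, of R]
        by (auto simp: R_def)
      obtain \<delta>\<^sub>2 where "\<delta>\<^sub>2 > 0" and \<delta>\<^sub>2: "\<And>v. v \<in> V\<^sub>2 \<Longrightarrow> far_radius v F\<^sub>2 \<le> R + \<delta>\<^sub>2 \<Longrightarrow>
          \<exists>w\<in>V\<^sub>2. far_radius w F\<^sub>2 \<le> R \<and> norm (v - w) \<le> \<epsilon>"
        using property_P1_near_sublevel[OF assms(8) CB(2) assms(6) F12(3,4) _ \<epsilon>, of R]
        by (auto simp: R_def)
      have "x \<in> {c + \<epsilon> *\<^sub>R b | c b. c \<in> cent ?V F \<and> b \<in> cball 0 1}"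
        if "x \<in> near_cent ?V F (min \<delta>\<^sub>1 \<delta>\<^sub>2)" for x
      proof -
        from that obtain v w where x: "x = of_pair (v, w)" and vw: "v \<in> V\<^sub>1" "w \<in> V\<^sub>2"
          and "far_radius v F\<^sub>1 \<le> R + \<delta>\<^sub>1" "far_radius w F\<^sub>2 \<le> R + \<delta>\<^sub>2"
          by (auto simp: near_cent_def rad far)
        then obtain v' w' where v': "v' \<in> V\<^sub>1" "far_radius v' F\<^sub>1 \<le> R" "norm (v - v') \<le> \<epsilon>"
          and w': "w' \<in> V\<^sub>2" "far_radius w' F\<^sub>2 \<le> R" "norm (w - w') \<le> \<epsilon>"
          using \<delta>\<^sub>1 \<delta>\<^sub>2 by meson
        define c where "c = of_pair (v', w')"
        have "c \<in> cent ?V F"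
          unfolding c_def using v' w' by (intro cent)
        \<comment> \<open>In the maximum norm the two coordinate errors do not add up, so \<epsilon>
          need not be split.\<close>
        moreover have "norm (x - c) \<le> \<epsilon>"
          using v' w' by (simp add: x c_def norm_of_pair minus_inf_sum.abs_eq)
        \<comment> \<open>Rescaling \<open>x - c\<close> supplies the unit-ball witness
          \<open>b\<close>.\<close>
        then have "inverse \<epsilon> *\<^sub>R (x - c) \<in> cball 0 1"
          using \<epsilon> by (simp add: inverse_eq_divide pos_divide_le_eq)
        moreover have "x = c + \<epsilon> *\<^sub>R (inverse \<epsilon> *\<^sub>R (x - c))"
          using \<epsilon> by simp
        ultimately show ?thesis
          by blast
      qed
      then show ?thesis
        using \<open>\<delta>\<^sub>1 > 0\<close> \<open>\<delta>\<^sub>2 > 0\<close> by (intro exI[of _ "min \<delta>\<^sub>1 \<delta>\<^sub>2"]) auto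
    qed
    ultimately show ?thesis
      by blast
  qed
  then show ?thesis
    unfolding property_P1_def rcp_def by blast
qed

end
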